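(* Let $V(x)=\sum_{k=-1}^\infty V_kx^k$ with $V_k\in M_N(\mathbb{C})$ and let $P_k$ be the associated maps. If $\theta_1,\theta_2\in M_N(\mathbb{C}[x])$, then for every $k\in\mathbb{N}$ $$P_k(\theta_1\theta_2)=\sum_{s=0}^k\left\{P_{k-s}(\theta_1)\frac{\theta_2^{(s)}(0)}{s!}+\frac{\theta_1^{(s)}(0)}{s!}P_{k-s}(\theta_2)\right\}.$$
   Context: $V$ is a (formal) Laurent series with at most a simple pole at $0$ (in the paper, a solution of $V''=V'V$). $\mathbb{N}$ includes $0$. For $k\in\mathbb{N}$ and $\theta\in M_N(\mathbb{C}[x])$, $$P_k(\theta)=\frac{\theta^{(k)}(0)}{(k-1)!}-\frac12\sum_{j=0}^k\left[\frac{\theta^{(j)}(0)}{j!},V_{k-1-j}\right],$$ where $[a,b]=ab-ba$ and $\frac{1}{(k-1)!}$ is read as $\frac{k}{k!}$, so as $0$ when $k=0$. *)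

theory Defs
  imports "HOL-Analysis.Analysis" "HOL-Computational_Algebra.Formal_Laurent_Series"
begin

text \<open>
  \<open>M_N(R)\<close> is the type \<open>R ^ 'n ^ 'n\<close> with \<open>N = CARD('n)\<close>. Its ring multiplication is \<open>**\<close>;
  the operation \<open>*\<close> on this type is entrywise. A Laurent series with coefficients in
  \<open>M_N(\<complex>)\<close> is represented by its matrix of scalar Laurent series, of type \<open>complex fls ^ 'n ^ 'n\<close>.
\<close>

definition laurent_coeff :: "complex fls ^ 'n ^ 'n \<Rightarrow> int \<Rightarrow> complex ^ 'n ^ 'n" where
  "laurent_coeff V k = map_matrix (\<lambda>f. fls_nth f k) V"

definition at_most_simple_pole :: "complex fls ^ 'n ^ 'n \<Rightarrow> bool" where
  "at_most_simple_pole V \<longleftrightarrow> (\<forall>k < -1. laurent_coeff V k = 0)"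

definition deriv_at_0 :: "nat \<Rightarrow> complex poly ^ 'n ^ 'n \<Rightarrow> complex ^ 'n ^ 'n" where
  "deriv_at_0 j \<theta> = map_matrix (\<lambda>p. poly p 0) ((map_matrix pderiv ^^ j) \<theta>)"

definition commutator :: "complex ^ 'n ^ 'n \<Rightarrow> complex ^ 'n ^ 'n \<Rightarrow> complex ^ 'n ^ 'n" where
  "commutator A B = A ** B - B ** A"

text \<open>The factor \<open>1 / (k - 1)!\<close> is read as \<open>k / k!\<close>, which is \<open>0\<close> for \<open>k = 0\<close>.\<close>

definition P :: "complex fls ^ 'n ^ 'n \<Rightarrow> nat \<Rightarrow> complex poly ^ 'n ^ 'n \<Rightarrow> complex ^ 'n ^ 'n" where
  "P V k \<theta> =
     (real k / fact k) *\<^sub>R deriv_at_0 k \<theta>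
     - (1 / 2) *\<^sub>R (\<Sum>j = 0..k. commutator ((1 / fact j) *\<^sub>R deriv_at_0 j \<theta>)
                                       (laurent_coeff V (int k - 1 - int j)))"

end

theory Submission
  imports Defs "HOL-Computational_Algebra.Polynomial_FPS"
begin

text \<open>
  The Taylor coefficients \<open>\<theta>\<^bsup>(j)\<^esup>(0) / j!\<close> are the coefficients of \<open>\<theta>\<close>, so with \<open>W = x V / 2\<close>, a
  matrix of power series because \<open>V\<close> has at most a simple pole, \<open>P\<^sub>k(\<theta>)\<close> is the coefficient of
  \<open>x\<^sup>k\<close> in \<open>D \<theta> = x \<theta>' - (\<theta> W - W \<theta>)\<close>. The map \<open>D\<close> is a derivation of the ring of matrices of power
  series, as the difference of the Euler derivation and an inner derivation. The claim is the
  coefficient of \<open>x\<^sup>k\<close> in the Leibniz rule \<open>D (\<theta>\<^sub>1 \<theta>\<^sub>2) = D \<theta>\<^sub>1 \<theta>\<^sub>2 + \<theta>\<^sub>1 D \<theta>\<^sub>2\<close>, expanded with the Cauchy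
  product (lemmas \<open>P_eq_coeff_twisted_euler\<close>, \<open>twisted_euler_mult\<close> and
  \<open>fps_matrix_nth_mult\<close>).
\<close>

definition fps_matrix_nth :: "'a fps ^ 'n ^ 'm \<Rightarrow> nat \<Rightarrow> 'a ^ 'n ^ 'm" where
  "fps_matrix_nth A k = map_matrix (\<lambda>f. fps_nth f k) A"

lemma fps_matrix_nth_add: "fps_matrix_nth (A + B) k = fps_matrix_nth A k + fps_matrix_nth B k"
  for A B :: "'a::monoid_add fps ^ 'n ^ 'm"
  by (simp add: fps_matrix_nth_def map_matrix_def vec_eq_iff)

lemma fps_matrix_nth_diff: "fps_matrix_nth (A - B) k = fps_matrix_nth A k - fps_matrix_nth B k"
  for A B :: "'a::group_add fps ^ 'n ^ 'm"
  by (simp add: fps_matrix_nth_def map_matrix_def vec_eq_iff)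

lemma fps_matrix_nth_mult:
  fixes A :: "'a::semiring_1 fps ^ 'n ^ 'm" and B :: "'a fps ^ 'p ^ 'n"
  shows "fps_matrix_nth (A ** B) k = (\<Sum>s = 0..k. fps_matrix_nth A s ** fps_matrix_nth B (k - s))"
proof -
  have "(\<Sum>l\<in>UNIV. \<Sum>s = 0..k. fps_nth (A $ i $ l) s * fps_nth (B $ l $ j) (k - s))
      = (\<Sum>s = 0..k. \<Sum>l\<in>UNIV. fps_nth (A $ i $ l) s * fps_nth (B $ l $ j) (k - s))" for i j
    by (rule sum.swap)
  then show ?thesis
    by (simp add: fps_matrix_nth_def map_matrix_def vec_eq_iff matrix_matrix_mult_def
        fps_sum_nth fps_mult_nth)
qed

text \<open>
  In the Leibniz formula for \<open>P\<close> the differentiated factor always has index \<open>k - s\<close>. When it is the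
  left factor, the Cauchy product has to be summed in the opposite order.
\<close>

lemma fps_matrix_nth_mult_rev:
  fixes A :: "'a::semiring_1 fps ^ 'n ^ 'm" and B :: "'a fps ^ 'p ^ 'n"
  shows "fps_matrix_nth (A ** B) k = (\<Sum>s = 0..k. fps_matrix_nth A (k - s) ** fps_matrix_nth B s)"
  unfolding fps_matrix_nth_mult
  by (subst sum.atLeastAtMost_rev) (intro sum.cong, auto)

definition euler_deriv :: "'a::comm_ring_1 fps ^ 'n ^ 'm \<Rightarrow> 'a fps ^ 'n ^ 'm" where
  "euler_deriv A = map_matrix (\<lambda>f. fps_X * fps_deriv f) A"

lemma euler_deriv_mult: "euler_deriv (A ** B) = euler_deriv A ** B + A ** euler_deriv B"
  for A :: "'a::comm_ring_1 fps ^ 'n ^ 'm" and B :: "'a fps ^ 'p ^ 'n"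
  by (simp add: euler_deriv_def map_matrix_def vec_eq_iff matrix_matrix_mult_def fps_deriv_sum
      sum_distrib_left sum.distrib algebra_simps)

definition twisted_euler ::
    "'a::comm_ring_1 fps ^ 'n ^ 'n \<Rightarrow> 'a fps ^ 'n ^ 'n \<Rightarrow> 'a fps ^ 'n ^ 'n" where
  "twisted_euler W A = euler_deriv A - (A ** W - W ** A)"

lemma matrix_diff_ldistrib: "A ** (B - C) = A ** B - A ** C"
  for A :: "'a::ring_1 ^ 'n ^ 'm"
  by (simp add: vec_eq_iff matrix_matrix_mult_def algebra_simps sum_subtractf)

lemma matrix_diff_rdistrib: "(B - C) ** A = B ** A - C ** A"
  for A :: "'a::ring_1 ^ 'n ^ 'm"
  by (simp add: vec_eq_iff matrix_matrix_mult_def algebra_simps sum_subtractf)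

text \<open>
  The commutator part obeys the Leibniz rule because the two middle terms \<open>A W B\<close> in
  \<open>(A W - W A) B + A (B W - W B)\<close> cancel by associativity.
\<close>

lemma twisted_euler_mult:
  "twisted_euler W (A ** B) = twisted_euler W A ** B + A ** twisted_euler W B"
  by (simp add: twisted_euler_def euler_deriv_mult matrix_diff_ldistrib matrix_diff_rdistrib
      matrix_mul_assoc)

definition poly_matrix_fps :: "'a::zero poly ^ 'n ^ 'm \<Rightarrow> 'a fps ^ 'n ^ 'm" where
  "poly_matrix_fps \<theta> = map_matrix fps_of_poly \<theta>"

lemma poly_matrix_fps_mult:
  "poly_matrix_fps (\<theta> ** \<eta>) = poly_matrix_fps \<theta> ** poly_matrix_fps \<eta>"
  for \<theta> :: "'a::comm_ring_1 poly ^ 'n ^ 'm" and \<eta> :: "'a poly ^ 'p ^ 'n"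
  by (simp add: poly_matrix_fps_def map_matrix_def vec_eq_iff matrix_matrix_mult_def
      fps_of_poly_mult fps_of_poly_sum)

lemma taylor_coeff_eq_fps_matrix_nth:
  "(1 / fact j) *\<^sub>R deriv_at_0 j \<theta> = fps_matrix_nth (poly_matrix_fps \<theta>) j"
proof -
  have iterate: "(map_matrix pderiv ^^ j) \<theta> = map_matrix (pderiv ^^ j) \<theta>"
    by (induction j) (simp_all add: map_matrix_def vec_eq_iff)
  have "poly ((pderiv ^^ j) p) 0 = fact j * coeff p j" for p :: "complex poly"
    by (simp add: poly_0_coeff_0 coeff_higher_pderiv pochhammer_fact)
  then show ?thesis
    by (simp add: deriv_at_0_def iterate fps_matrix_nth_def poly_matrix_fps_def map_matrix_def
        vec_eq_iff scaleR_conv_of_real [where 'a = complex])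
qed

text \<open>
  For \<open>V\<close> with at most a simple pole this is \<open>x V / 2\<close>, read as a matrix of power series.
  The factor \<open>1 / 2\<close> is absorbed here so that the commutator in \<^const>\<open>twisted_euler\<close> carries no scalar.
\<close>

definition half_x_times :: "complex fls ^ 'n ^ 'n \<Rightarrow> complex fps ^ 'n ^ 'n" where
  "half_x_times V = map_matrix (\<lambda>f. Abs_fps (\<lambda>i. fls_nth f (int i - 1) / 2)) V"

lemma fps_matrix_nth_half_x_times:
  "fps_matrix_nth (half_x_times V) i = (1 / 2) *\<^sub>R laurent_coeff V (int i - 1)"
  by (simp add: fps_matrix_nth_def half_x_times_def laurent_coeff_def map_matrix_def vec_eq_iff
      scaleR_conv_of_real [where 'a = complex])

lemma fps_matrix_nth_euler_deriv:
  "fps_matrix_nth (euler_deriv A) k = real k *\<^sub>R fps_matrix_nth A k"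
  for A :: "complex fps ^ 'n ^ 'n"
  by (cases k) (simp_all add: fps_matrix_nth_def euler_deriv_def map_matrix_def vec_eq_iff
      scaleR_conv_of_real [where 'a = complex])

text \<open>
  Multiplying \<open>V\<close> by \<open>x\<close> turns the index \<open>k - 1 - j\<close> of \<open>V\<close> into \<open>k - j\<close>, so that the sum of
  commutators becomes a difference of two Cauchy products; \<open>k\<close> times the Taylor coefficient comes
  from the Euler derivation, also for \<open>k = 0\<close>.
\<close>

lemma P_eq_coeff_twisted_euler:
  "P V k \<theta> = fps_matrix_nth (twisted_euler (half_x_times V) (poly_matrix_fps \<theta>)) k"
proof -
  let ?A = "fps_matrix_nth (poly_matrix_fps \<theta>)"
  let ?W = "fps_matrix_nth (half_x_times V)"
  have lead: "(real k / fact k) *\<^sub>R deriv_at_0 k \<theta> = real k *\<^sub>R ?A k"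
    by (simp flip: taylor_coeff_eq_fps_matrix_nth)
  have "(1 / 2) *\<^sub>R commutator ((1 / fact j) *\<^sub>R deriv_at_0 j \<theta>) (laurent_coeff V (int k - 1 - int j))
      = ?A j ** ?W (k - j) - ?W (k - j) ** ?A j" if "j \<in> {0..k}" for j
  proof -
    have "laurent_coeff V (int k - 1 - int j) = laurent_coeff V (int (k - j) - 1)"
      using that by (simp add: of_nat_diff algebra_simps)
    then show ?thesis
      by (simp add: commutator_def taylor_coeff_eq_fps_matrix_nth fps_matrix_nth_half_x_times
          matrix_scalar_ac scalar_matrix_assoc scaleR_right_diff_distrib)
  qed
  then have "(1 / 2) *\<^sub>R (\<Sum>j = 0..k. commutator ((1 / fact j) *\<^sub>R deriv_at_0 j \<theta>)
                                       (laurent_coeff V (int k - 1 - int j)))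
      = (\<Sum>j = 0..k. ?A j ** ?W (k - j) - ?W (k - j) ** ?A j)"
    by (simp add: scaleR_sum_right)
  then show ?thesis
    by (simp only: P_def lead twisted_euler_def fps_matrix_nth_diff fps_matrix_nth_euler_deriv
        fps_matrix_nth_mult [of "poly_matrix_fps \<theta>"]
        fps_matrix_nth_mult_rev [of "half_x_times V"] sum_subtractf)
qed

theorem lemma3:
  fixes V :: "complex fls ^ 'n ^ 'n"
    and \<theta>\<^sub>1 \<theta>\<^sub>2 :: "complex poly ^ 'n ^ 'n"
    and k :: nat
  assumes "at_most_simple_pole V"
  shows "P V k (\<theta>\<^sub>1 ** \<theta>\<^sub>2) =
    (\<Sum>s = 0..k. P V (k - s) \<theta>\<^sub>1 ** ((1 / fact s) *\<^sub>R deriv_at_0 s \<theta>\<^sub>2)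
               + ((1 / fact s) *\<^sub>R deriv_at_0 s \<theta>\<^sub>1) ** P V (k - s) \<theta>\<^sub>2)"
proof -
  let ?D = "twisted_euler (half_x_times V)"
  let ?A = "poly_matrix_fps \<theta>\<^sub>1"
  let ?B = "poly_matrix_fps \<theta>\<^sub>2"
  have "P V k (\<theta>\<^sub>1 ** \<theta>\<^sub>2) = fps_matrix_nth (?D ?A ** ?B) k + fps_matrix_nth (?A ** ?D ?B) k"
    by (simp only: P_eq_coeff_twisted_euler poly_matrix_fps_mult twisted_euler_mult fps_matrix_nth_add)
  then show ?thesis
    by (simp only: P_eq_coeff_twisted_euler taylor_coeff_eq_fps_matrix_nth sum.distrib
        fps_matrix_nth_mult [of ?A] fps_matrix_nth_mult_rev [of "?D ?A"])
qed

end
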